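(* The Riemann zeta function $\zeta(s)$ has no zeros in the region of complex numbers $s$ satisfying $|s-1| \leq 2.2093$ and $0 \leq \Re(s) \leq 1$.
   Context: $\zeta(s)$ denotes the Riemann zeta function, meromorphically continued to $\mathbb{C}$, with its only pole (simple) at $s=1$. *)

theory Defs
  imports "HOL-Complex_Analysis.Complex_Analysis"
begin

text \<open>
  The Riemann zeta function is the unique meromorphic function on the complex plane whose value for
  \<open>Re s > 1\<close> is the Dirichlet series \<open>1 + 2\<^sup>-\<^sup>s + 3\<^sup>-\<^sup>s + \<dots>\<close>. Uniqueness as a function requires
  fixing its value at the pole: a nicely meromorphic function takes the value 0 at its poles, so
  \<open>zeta 1 = 0\<close>, although 1 is not a zero of the zeta function.
  Existence and uniqueness are the theorem \<open>zeta_exists_unique\<close> below.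
\<close>
definition zeta :: "complex \<Rightarrow> complex" where
  "zeta = (THE f. f nicely_meromorphic_on UNIV \<and>
                  (\<forall>s. Re s > 1 \<longrightarrow> (\<lambda>n. 1 / of_nat (Suc n) powr s) sums f s))"


subsection \<open>Existence and uniqueness of the continuation\<close>

text \<open>
  For \<open>Re s > 1\<close> one has \<open>1 = (\<Sum>n\<ge>1. n powr (1-s) - (n+1) powr (1-s))\<close>. Expanding \<open>(n+1) powr (1-s)\<close>
  to order \<open>K\<close> in \<open>1/n\<close> expresses \<open>(s-1) \<zeta>(s)\<close> by the values \<open>(s+i-1) \<zeta>(s+i)\<close>, \<open>0 < i < K\<close>, and a
  remainder series that converges for \<open>Re s > 1 - K\<close>.
\<close>

definition zeta_rem :: "nat \<Rightarrow> nat \<Rightarrow> complex \<Rightarrow> complex" where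
  "zeta_rem K n s = of_nat (Suc (Suc n)) powr (1 - s) -
     (\<Sum>i\<le>K. ((1 - s) gchoose i) * of_nat (Suc n) powr (1 - s - of_nat i))"

lemma powr_one_plus_Taylor:
  fixes a :: complex and t :: real
  assumes t: "0 \<le> t" "t \<le> 1" and a: "Re a \<le> real K + 1"
  shows "cmod ((1 + of_real t) powr a - (\<Sum>i\<le>K. (a gchoose i) * of_real t ^ i))
           \<le> cmod (\<Prod>j<Suc K. a - of_nat j) * t ^ Suc K / fact K"
proof -
  define f :: "nat \<Rightarrow> complex \<Rightarrow> complex"
    where "f = (\<lambda>i x. (\<Prod>j<i. a - of_nat j) * (1 + x) powr (a - of_nat i))"
  define S where "S = closed_segment 0 (1::complex)"
  have S: "\<exists>r. x = of_real r \<and> 0 \<le> r \<and> r \<le> 1" if "x \<in> S" for x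
    using that unfolding S_def closed_segment_def by (auto simp: scaleR_conv_of_real)
  have "cmod (f 0 (of_real t) - (\<Sum>i\<le>K. f i 0 * (of_real t - 0) ^ i / fact i))
          \<le> cmod (\<Prod>j<Suc K. a - of_nat j) * cmod (of_real t - 0) ^ Suc K / fact K"
  proof (rule complex_Taylor)
    show "convex S" by (simp add: S_def)
    show "(f i has_field_derivative f (Suc i) x) (at x within S)" if x: "x \<in> S" for i x
    proof -
      from S[OF x] have "1 + x \<notin> \<real>\<^sub>\<le>\<^sub>0"
        by (auto simp: complex_nonpos_Reals_iff)
      thus ?thesis
        unfolding f_def by (auto intro!: derivative_eq_intros simp: algebra_simps)
    qed
    show "cmod (f (Suc K) x) \<le> cmod (\<Prod>j<Suc K. a - of_nat j)" if x: "x \<in> S" for x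
    proof -
      from S[OF x] obtain r where r: "x = of_real r" "0 \<le> r" "r \<le> 1" by auto
      have "cmod ((1 + x) powr (a - of_nat (Suc K))) = cmod (of_real (1 + r) powr (a - of_nat (Suc K)))"
        using r by simp
      also have "\<dots> = (1 + r) powr (Re a - real (Suc K))"
        using r by (subst norm_powr_real_powr) auto
      also have "\<dots> \<le> (1 + r) powr 0"
        using r a by (intro powr_mono) auto
      finally show ?thesis
        using r unfolding f_def norm_mult by (intro mult_left_le) auto
    qed
    show "0 \<in> S" by (simp add: S_def)
    show "complex_of_real t \<in> S"
      using t unfolding S_def closed_segment_def by (auto simp: scaleR_conv_of_real)
  qed
  thus ?thesis
    using t by (simp add: f_def gbinomial_prod_rev atLeast0LessThan norm_of_real)
qed

lemma norm_zeta_rem_le: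
  assumes s: "Re s \<ge> - real K"
  shows "cmod (zeta_rem K n s) \<le>
           cmod (\<Prod>j<Suc K. 1 - s - of_nat j) / fact K * real (Suc n) powr (- Re s - real K)"
proof -
  define x where "x = real (Suc n)"
  have x: "x \<ge> 1" by (simp add: x_def)
  have of_nat: "of_nat (Suc n) = complex_of_real x" "of_nat (Suc (Suc n)) = complex_of_real (x * (1 + 1 / x))"
    using x by (simp_all add: x_def distrib_left del: of_nat_Suc) simp_all
  have 1: "complex_of_real (x * (1 + 1 / x)) powr (1 - s) =
             complex_of_real x powr (1 - s) * (1 + of_real (1 / x)) powr (1 - s)"
    using x by (subst powr_times_real [symmetric]) auto
  have 2: "complex_of_real x powr (1 - s - of_nat i) =
             complex_of_real x powr (1 - s) * of_real (1 / x) ^ i" for i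
    using x by (simp add: powr_diff power_divide powr_nat')
  have "zeta_rem K n s = complex_of_real x powr (1 - s) *
     ((1 + of_real (1 / x)) powr (1 - s) - (\<Sum>i\<le>K. ((1 - s) gchoose i) * of_real (1 / x) ^ i))"
    unfolding zeta_rem_def of_nat 1 2 by (simp add: algebra_simps sum_distrib_left)
  also have "cmod \<dots> \<le> x powr (1 - Re s) * (cmod (\<Prod>j<Suc K. 1 - s - of_nat j) * (1 / x) ^ Suc K / fact K)"
    unfolding norm_mult using x s
    by (intro mult_mono powr_one_plus_Taylor) (auto simp: norm_powr_real_powr)
  also have "(1 / x) ^ Suc K = x powr (- real (Suc K))"
    using x by (simp add: powr_minus powr_realpow power_one_over inverse_eq_divide del: power_Suc of_nat_Suc)
  also have "x powr (1 - Re s) * (cmod (\<Prod>j<Suc K. 1 - s - of_nat j) * x powr (- real (Suc K)) / fact K) =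
     cmod (\<Prod>j<Suc K. 1 - s - of_nat j) / fact K * (x powr (1 - Re s) * x powr (- real (Suc K)))"
    by simp
  also have "x powr (1 - Re s) * x powr (- real (Suc K)) = x powr (- Re s - real K)"
    by (simp add: powr_add [symmetric])
  finally show ?thesis by (simp add: x_def)
qed

lemma summable_Suc_powr: "a < -1 \<Longrightarrow> summable (\<lambda>n. real (Suc n) powr a)"
  using summable_real_powr_iff [of a] summable_Suc_iff [of "\<lambda>n. real n powr a"] by simp

lemma zeta_rem_sums:
  assumes "Re s > 1 - real K"
  shows "summable (\<lambda>n. zeta_rem K n s)"
proof (rule summable_comparison_test')
  show "summable (\<lambda>n. cmod (\<Prod>j<Suc K. 1 - s - of_nat j) / fact K * real (Suc n) powr (- Re s - real K))"
    using assms by (intro summable_mult summable_Suc_powr) auto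
  show "cmod (zeta_rem K n s) \<le> cmod (\<Prod>j<Suc K. 1 - s - of_nat j) / fact K *
          real (Suc n) powr (- Re s - real K)" if "n \<ge> 0" for n
    using assms by (intro norm_zeta_rem_le) auto
qed

lemma holomorphic_zeta_rem: "zeta_rem K n holomorphic_on A"
  unfolding zeta_rem_def gbinomial_prod_rev
  by (intro holomorphic_intros) (auto simp: complex_nonpos_Reals_iff simp del: of_nat_Suc)

lemma holomorphic_suminf_zeta_rem:
  "(\<lambda>s. \<Sum>n. zeta_rem K n s) holomorphic_on {s. Re s > 1 - real K}"
proof (rule holomorphic_uniform_sequence)
  show "open {s. Re s > 1 - real K}" by (simp add: open_halfspace_Re_gt)
  show "(\<lambda>s. \<Sum>n<N. zeta_rem K n s) holomorphic_on {s. Re s > 1 - real K}" for N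
    by (intro holomorphic_intros holomorphic_zeta_rem)
  fix s assume s: "s \<in> {s. Re s > 1 - real K}"
  define d where "d = (Re s - (1 - real K)) / 2"
  have d: "d > 0" using s by (simp add: d_def)
  have Re_ge: "Re w \<ge> Re s - d" if "w \<in> cball s d" for w
    using that abs_Re_le_cmod [of "s - w"] by (auto simp: dist_norm)
  have sd: "Re s - d > 1 - real K" using s by (simp add: d_def field_simps)
  have "continuous_on (cball s d) (\<lambda>w. \<Prod>j<Suc K. 1 - w - of_nat j)"
    by (intro continuous_intros)
  then have "bounded ((\<lambda>w. \<Prod>j<Suc K. 1 - w - of_nat j) ` cball s d)"
    by (intro compact_imp_bounded compact_continuous_image) auto
  then obtain B where B: "\<And>w. w \<in> cball s d \<Longrightarrow> cmod (\<Prod>j<Suc K. 1 - w - of_nat j) \<le> B"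
    unfolding bounded_iff by blast
  have "uniform_limit (cball s d) (\<lambda>N s. \<Sum>n<N. zeta_rem K n s) (\<lambda>s. \<Sum>n. zeta_rem K n s) sequentially"
  proof (rule Weierstrass_m_test)
    show "summable (\<lambda>n. B / fact K * real (Suc n) powr (- (Re s - d) - real K))"
      using sd by (intro summable_mult summable_Suc_powr) auto
    fix n w assume w: "w \<in> cball s d"
    have "cmod (zeta_rem K n w) \<le>
            cmod (\<Prod>j<Suc K. 1 - w - of_nat j) / fact K * real (Suc n) powr (- Re w - real K)"
      using Re_ge[OF w] sd by (intro norm_zeta_rem_le) auto
    also have "\<dots> \<le> B / fact K * real (Suc n) powr (- (Re s - d) - real K)"
      using B[OF w] Re_ge[OF w] order.trans[OF norm_ge_zero B[OF w]]
      by (intro mult_mono powr_mono divide_right_mono) auto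
    finally show "cmod (zeta_rem K n w) \<le> B / fact K * real (Suc n) powr (- (Re s - d) - real K)" .
  qed
  with d sd Re_ge show "\<exists>d>0. cball s d \<subseteq> {s. Re s > 1 - real K} \<and>
      uniform_limit (cball s d) (\<lambda>N s. \<Sum>n<N. zeta_rem K n s) (\<lambda>s. \<Sum>n. zeta_rem K n s) sequentially"
    by (intro exI[of _ d]) force
qed

definition zeta_series :: "complex \<Rightarrow> complex" where
  "zeta_series s = (\<Sum>n. 1 / of_nat (Suc n) powr s)"

lemma zeta_series_sums:
  assumes "Re s > 1"
  shows "(\<lambda>n. 1 / of_nat (Suc n) powr s) sums zeta_series s"
  unfolding zeta_series_def
proof (rule summable_sums, rule summable_comparison_test')
  show "summable (\<lambda>n. real (Suc n) powr (- Re s))"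
    using assms by (intro summable_Suc_powr) auto
  show "cmod (1 / of_nat (Suc n) powr s) \<le> real (Suc n) powr (- Re s)" if "n \<ge> 0" for n
    using norm_powr_real_powr [of "of_nat (Suc n)" s]
    by (simp add: norm_divide powr_minus inverse_eq_divide del: of_nat_Suc)
qed

lemma zeta_series_recursion:
  assumes s: "Re s > 1"
  shows "(s - 1) * zeta_series s = 1 + (\<Sum>n. zeta_rem (Suc K) n s) +
           (\<Sum>i<K. ((1 - s) gchoose (i + 2)) * zeta_series (s + of_nat (i + 1)))"
proof -
  define f where "f = (\<lambda>n. of_nat (Suc n) powr (1 - s) :: complex)"
  have "(\<lambda>n. of_nat n powr (1 - s) :: complex) \<longlonglongrightarrow> 0"
    using tendsto_neg_powr_complex_of_nat [of "\<lambda>n. n" sequentially "1 - s"] s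
    by (simp add: filterlim_ident)
  hence "f \<longlonglongrightarrow> 0" unfolding f_def by (rule LIMSEQ_Suc)
  hence "(\<lambda>n. f (Suc n) - f n) sums (0 - f 0)" by (rule telescope_sums)
  moreover have "f 0 = 1" by (simp add: f_def)
  ultimately have 1: "(\<lambda>n. f (Suc n) - f n) sums (-1)" by simp
  have diff_eq: "f (Suc n) - f n = zeta_rem (Suc K) n s +
      (\<Sum>i\<le>K. ((1 - s) gchoose (Suc i)) * (1 / of_nat (Suc n) powr (s + of_nat i)))" for n
  proof -
    have "of_nat (Suc n) powr (1 - s - of_nat (Suc i)) = 1 / (of_nat (Suc n) powr (s + of_nat i) :: complex)" for i
      by (simp add: powr_minus_divide [symmetric] del: of_nat_Suc) (simp add: algebra_simps)
    thus ?thesis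
      unfolding zeta_rem_def f_def
      by (subst sum.atMost_Suc_shift) (simp del: of_nat_Suc gbinomial_Suc)
  qed
  have "(\<lambda>n. zeta_rem (Suc K) n s +
      (\<Sum>i\<le>K. ((1 - s) gchoose (Suc i)) * (1 / of_nat (Suc n) powr (s + of_nat i))))
      sums ((\<Sum>n. zeta_rem (Suc K) n s) + (\<Sum>i\<le>K. ((1 - s) gchoose (Suc i)) * zeta_series (s + of_nat i)))"
    using s by (intro sums_add sums_sum sums_mult summable_sums zeta_rem_sums zeta_series_sums) auto
  with 1 have "-1 = (\<Sum>n. zeta_rem (Suc K) n s) + (\<Sum>i\<le>K. ((1 - s) gchoose (Suc i)) * zeta_series (s + of_nat i))"
    unfolding diff_eq by (rule sums_unique2)
  also have "(\<Sum>i\<le>K. ((1 - s) gchoose (Suc i)) * zeta_series (s + of_nat i)) =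
      (1 - s) * zeta_series s + (\<Sum>i<K. ((1 - s) gchoose (i + 2)) * zeta_series (s + of_nat (i + 1)))"
    by (subst sum.atMost_shift) (simp del: of_nat_Suc gbinomial_Suc)
  finally show ?thesis by (simp add: algebra_simps)
qed

lemma gbinomial_shift_factor:
  "((1 - s) gchoose (i + 2)) =
     - ((\<Prod>j<Suc i. 1 - s - of_nat j) / fact (i + 2)) * (s + of_nat (i + 1) - 1)" for s :: complex
proof -
  have "(\<Prod>j<i + 2. 1 - s - of_nat j) =
          (\<Prod>j<Suc i. 1 - s - of_nat j) * - (s + of_nat (i + 1) - 1)"
    by (simp add: algebra_simps)
  thus ?thesis
    unfolding gbinomial_prod_rev atLeast0LessThan by (simp only: mult_minus_right mult_minus_left
      times_divide_eq_left minus_divide_left)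
qed

lemma zeta_continuation_halfplane:
  "\<exists>g. (K > 0 \<longrightarrow> g holomorphic_on {s. Re s > 1 - real K} \<and> g 1 = 1) \<and>
       (\<forall>s. Re s > 1 \<longrightarrow> g s = (s - 1) * zeta_series s)"
proof (induction K)
  case 0
  show ?case by (intro exI[of _ "\<lambda>s. (s - 1) * zeta_series s"]) auto
next
  case (Suc K)
  then obtain g where g: "K > 0 \<Longrightarrow> g holomorphic_on {s. Re s > 1 - real K}"
    "\<And>s. Re s > 1 \<Longrightarrow> g s = (s - 1) * zeta_series s" by blast
  define P where "P = (\<lambda>i s. (\<Prod>j<Suc i. 1 - s - of_nat j) / fact (i + 2) :: complex)"
  define h where "h = (\<lambda>s. 1 + (\<Sum>n. zeta_rem (Suc K) n s) - (\<Sum>i<K. P i s * g (s + of_nat (i + 1))))"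
  have "h holomorphic_on {s. Re s > 1 - real (Suc K)}"
  proof -
    have *: "(\<lambda>s. g (s + of_nat (i + 1))) holomorphic_on {s. Re s > 1 - real (Suc K)}" if "i < K" for i
    proof -
      have "g \<circ> (\<lambda>s. s + of_nat (i + 1)) holomorphic_on {s. Re s > 1 - real (Suc K)}"
        using that by (intro holomorphic_on_compose_gen [OF _ g(1)] holomorphic_intros) auto
      thus ?thesis by (simp add: o_def)
    qed
    show ?thesis
      unfolding h_def P_def by (intro holomorphic_intros holomorphic_suminf_zeta_rem *) auto
  qed
  moreover have "h 1 = 1"
  proof -
    have "zeta_rem (Suc K) n 1 = 0" for n
      unfolding zeta_rem_def by (subst sum.atMost_Suc_shift) (simp add: gbinomial_0_left del: of_nat_Suc gbinomial_Suc)
    moreover have "P i 1 = 0" for i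
      unfolding P_def by (subst prod.lessThan_Suc_shift) simp
    ultimately show ?thesis by (simp add: h_def)
  qed
  moreover have "h s = (s - 1) * zeta_series s" if s: "Re s > 1" for s
  proof -
    have "((1 - s) gchoose (i + 2)) * zeta_series (s + of_nat (i + 1)) = - (P i s * g (s + of_nat (i + 1)))" for i
      using s unfolding gbinomial_shift_factor P_def by (subst g(2)) (auto simp del: prod.lessThan_Suc)
    thus ?thesis
      unfolding h_def zeta_series_recursion [OF s, of K] by (simp add: sum_negf)
  qed
  ultimately show ?case by blast
qed

lemma zeta_continuation_entire:
  "\<exists>g. g holomorphic_on UNIV \<and> g 1 = 1 \<and> (\<forall>s. Re s > 1 \<longrightarrow> g s = (s - 1) * zeta_series s)"
proof -
  define H where "H = (\<lambda>K. {s. Re s > 1 - real (Suc K)})"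
  have "\<forall>K. \<exists>g. g holomorphic_on H K \<and> g 1 = 1 \<and> (\<forall>s. Re s > 1 \<longrightarrow> g s = (s - 1) * zeta_series s)"
    unfolding H_def using zeta_continuation_halfplane by blast
  then obtain g where g: "\<And>K. g K holomorphic_on H K" "\<And>K. g K 1 = 1"
    "\<And>K s. Re s > 1 \<Longrightarrow> g K s = (s - 1) * zeta_series s" by metis
  have open_H: "open (H K)" for K by (simp add: H_def open_halfspace_Re_gt)
  have mono: "H K \<subseteq> H L" if "K \<le> L" for K L using that by (auto simp: H_def)
  have eq: "g K s = g L s" if "K \<le> L" "s \<in> H K" for K L s
  proof (rule analytic_continuation_open [of "{s. Re s > 1}" "H K" "g K" "g L"])
    show "{s. Re s > 1} \<noteq> {}" by (auto intro: exI[of _ 2])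
    show "connected (H K)" unfolding H_def by (intro convex_connected convex_halfspace_Re_gt)
    show "g L holomorphic_on H K" using g(1) mono[OF that(1)] by (rule holomorphic_on_subset)
  qed (use that g in \<open>auto simp: open_halfspace_Re_gt open_H\<close>, auto simp: H_def)
  define N where "N = (\<lambda>s. LEAST K. s \<in> H K)"
  have N: "s \<in> H (N s)" for s
  proof -
    obtain K where "real K > 1 - Re s" using reals_Archimedean2 by blast
    hence "s \<in> H K" by (auto simp: H_def)
    thus ?thesis unfolding N_def by (rule LeastI)
  qed
  define G where "G = (\<lambda>s. g (N s) s)"
  have G: "G s = g K s" if "s \<in> H K" for s K
    unfolding G_def by (rule eq [OF _ N]) (use that in \<open>auto simp: N_def intro: Least_le\<close>)
  have "G holomorphic_on H K" for K
    using g(1)[of K] by (rule holomorphic_transform) (simp add: G)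
  hence "G holomorphic_on (\<Union>K. H K)"
    by (intro holomorphic_on_UN_open open_H)
  also have "(\<Union>K. H K) = UNIV" using N by blast
  finally show ?thesis
    by (intro exI[of _ G]) (auto simp: G_def g)
qed

lemma nicely_meromorphic_eqI:
  assumes f: "f nicely_meromorphic_on UNIV" and g: "g nicely_meromorphic_on UNIV"
    and eq: "\<And>s. Re s > 1 \<Longrightarrow> f s = g s"
  shows "f = g"
proof
  fix z :: complex
  define d where "d = (\<lambda>s. f s - g s)"
  have mero: "d meromorphic_on UNIV"
    using f g unfolding d_def nicely_meromorphic_on_def by (intro meromorphic_intros) auto
  have d0: "remove_sings d s = 0" if "Re s > 1" for s
  proof -
    have "eventually (\<lambda>w. w \<in> {w. Re w > 1}) (at s)"
      using that by (intro eventually_at_in_open') (auto simp: open_halfspace_Re_gt)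
    hence "eventually (\<lambda>w. d w = 0) (at s)"
      by eventually_elim (simp add: d_def eq)
    hence "d \<midarrow>s\<rightarrow> 0" by (rule tendsto_eventually)
    thus ?thesis by (rule remove_sings_eqI)
  qed
  have "eventually (\<lambda>w. w \<in> {w. Re w > 1}) (at (2::complex))"
    by (intro eventually_at_in_open') (auto simp: open_halfspace_Re_gt)
  hence "eventually (\<lambda>w. remove_sings d w = 0) (at (2::complex))"
    by eventually_elim (simp add: d0)
  hence "frequently (\<lambda>w. remove_sings d w = 0) (at (2::complex))"
    by (intro eventually_frequently) auto
  from frequently_eq_meromorphic_imp_constant [OF this remove_sings_nicely_meromorphic [OF mero]]
  have "remove_sings d w = 0" for w by auto
  moreover have "eventually (\<lambda>w. remove_sings d w = d w) (at z)"
    using mero by (intro eventually_remove_sings_eq_at meromorphic_on_isolated_singularity)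
      (auto intro: meromorphic_on_subset)
  ultimately have ev: "eventually (\<lambda>w. f w = g w) (at z)"
    by (simp add: d_def)
  have pole: "is_pole f z \<longleftrightarrow> is_pole g z"
    using ev by (intro is_pole_cong refl)
  show "f z = g z"
  proof (cases "is_pole f z")
    case True
    thus ?thesis
      using is_pole_zero_at_nicely_mero [OF f] is_pole_zero_at_nicely_mero [OF g] pole by simp
  next
    case False
    hence "f \<midarrow>z\<rightarrow> f z" "g \<midarrow>z\<rightarrow> g z"
      using f g pole by (auto simp: nicely_meromorphic_on_def)
    moreover from this(1) have "g \<midarrow>z\<rightarrow> f z"
      using ev by (rule Lim_transform_eventually)
    ultimately show ?thesis by (metis LIM_unique)
  qed
qed

lemma zeta_continuation:
  assumes g: "g holomorphic_on UNIV" "g 1 = 1"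
    "\<And>s. Re s > 1 \<Longrightarrow> g s = (s - 1) * zeta_series s"
  defines "f \<equiv> (\<lambda>s. if s = 1 then 0 else g s / (s - 1))"
  shows "f nicely_meromorphic_on UNIV"
    and "Re s > 1 \<Longrightarrow> (\<lambda>n. 1 / of_nat (Suc n) powr s) sums f s"
proof -
  have "is_pole (\<lambda>s. g s / (s - 1) ^ 1) 1"
    using g by (intro is_pole_basic [of g UNIV]) auto
  also have "?this \<longleftrightarrow> is_pole f 1"
    by (intro is_pole_cong) (auto simp: f_def eventually_at_filter)
  finally have pole: "is_pole f 1" .
  have "(\<lambda>s. g s / (s - 1)) holomorphic_on - {1}"
    by (intro holomorphic_intros holomorphic_on_subset [OF g(1)]) auto
  hence holo: "f holomorphic_on - {1}"
    by (rule holomorphic_transform) (auto simp: f_def)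
  show "f nicely_meromorphic_on UNIV"
  proof (rule nicely_meromorphic_onI_open [where pts = "{1}"])
    show "f analytic_on UNIV - {1}"
      using holo by (simp add: analytic_on_open Compl_eq_Diff_UNIV open_delete)
    show "isolated_singularity_at f s" for s
    proof (rule isolated_singularity_at_holomorphic)
      show "f holomorphic_on (if s = 1 then UNIV else - {1}) - {s}"
        using holo by (rule holomorphic_on_subset) auto
    qed auto
  qed (use pole in \<open>auto simp: f_def\<close>)
  assume s: "Re s > 1"
  hence "f s = zeta_series s" by (auto simp: f_def g)
  thus "(\<lambda>n. 1 / of_nat (Suc n) powr s) sums f s"
    using zeta_series_sums [OF s] by simp
qed

theorem zeta_exists_unique:
  "\<exists>!f. f nicely_meromorphic_on UNIV \<and>
        (\<forall>s. Re s > 1 \<longrightarrow> (\<lambda>n. 1 / of_nat (Suc n) powr s) sums f s)"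
proof -
  obtain g where g: "g holomorphic_on UNIV" "g 1 = 1"
    "\<And>s. Re s > 1 \<Longrightarrow> g s = (s - 1) * zeta_series s"
    using zeta_continuation_entire by blast
  from zeta_continuation [OF g] show ?thesis
    by (blast intro: nicely_meromorphic_eqI sums_unique2)
qed

lemma nicely_meromorphic_zeta: "zeta nicely_meromorphic_on UNIV"
  and zeta_sums: "Re s > 1 \<Longrightarrow> (\<lambda>n. 1 / of_nat (Suc n) powr s) sums zeta s"
  using theI' [OF zeta_exists_unique] unfolding zeta_def by blast+

text \<open>The only singularity of \<open>zeta\<close> is a simple pole at 1.\<close>

theorem zeta_eq_entire_divide:
  obtains g where "g holomorphic_on UNIV" "g 1 = 1" "\<And>s. s \<noteq> 1 \<Longrightarrow> zeta s = g s / (s - 1)"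
proof -
  obtain g where g: "g holomorphic_on UNIV" "g 1 = 1"
    "\<And>s. Re s > 1 \<Longrightarrow> g s = (s - 1) * zeta_series s"
    using zeta_continuation_entire by blast
  have "zeta = (\<lambda>s. if s = 1 then 0 else g s / (s - 1))"
    using zeta_continuation [OF g] nicely_meromorphic_zeta zeta_sums
    by (blast intro: nicely_meromorphic_eqI sums_unique2)
  from fun_cong [OF this] show thesis by (intro that [OF g(1,2)]) simp
qed

corollary holomorphic_zeta: "zeta holomorphic_on - {1}"
proof -
  obtain g where g: "g holomorphic_on UNIV" "\<And>s. s \<noteq> 1 \<Longrightarrow> zeta s = g s / (s - 1)"
    using zeta_eq_entire_divide by blast
  have "(\<lambda>s. g s / (s - 1)) holomorphic_on - {1}"
    by (intro holomorphic_intros holomorphic_on_subset [OF g(1)]) auto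
  thus ?thesis by (rule holomorphic_transform) (simp add: g)
qed

corollary is_pole_zeta: "is_pole zeta 1"
  and zorder_zeta: "zorder zeta 1 = -1"
proof -
  obtain g where g: "g holomorphic_on UNIV" "g 1 = 1" "\<And>s. s \<noteq> 1 \<Longrightarrow> zeta s = g s / (s - 1)"
    using zeta_eq_entire_divide by blast
  have "is_pole (\<lambda>s. g s / (s - 1) ^ 1) 1"
    using g by (intro is_pole_basic [of g UNIV]) auto
  also have "?this \<longleftrightarrow> is_pole zeta 1"
    by (intro is_pole_cong) (auto simp: g eventually_at_filter)
  finally show "is_pole zeta 1" .
  show "zorder zeta 1 = -1"
    using g by (intro zorder_eqI [of UNIV 1 g]) (auto simp: field_simps power_int_minus)
qed

end

theory Submission
  imports Defs
begin

text \<open>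
  Euler--Maclaurin summation of \<open>n powr -s\<close> to third order, started at \<open>n = 1\<close>, gives
  \<open>(s - 1) \<zeta>(s) = (s + 2) (s + 3) / 12 + R(s)\<close> for \<open>Re s > -1\<close>, where \<open>R(s)\<close> is bounded by
  \<open>\<bar>(s - 1) s (s + 1) (s + 2)\<bar> / 120\<close> because the third Bernoulli polynomial is bounded by \<open>1/20\<close> on
  the unit interval. At a zero of \<open>\<zeta>\<close> this forces \<open>10 \<bar>s + 3\<bar> \<le> \<bar>s - 1\<bar> \<bar>s\<bar> \<bar>s + 1\<bar>\<close>, whereas
  in the region the left-hand side is at least 30 and the right-hand side is less than 30.
\<close>

lemma bernoulli3_le:
  fixes y :: real
  assumes "0 \<le> y" "y \<le> 1"
  shows "y * (y - 1/2) * (y - 1) \<le> 1/20"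
proof -
  \<comment> \<open>The square is almost tangent at the maximum \<open>(1 - 1 / sqrt 3) / 2\<close>.\<close>
  have "1/20 - y * (y - 1/2) * (y - 1) =
          (y - 21/100)\<^sup>2 * (27/25 - y) + (593 - 575 * y) / 250000"
    by (simp add: power2_eq_square field_simps)
  moreover have "(y - 21/100)\<^sup>2 * (27/25 - y) \<ge> 0" "(593 - 575 * y) / 250000 \<ge> 0"
    using assms by auto
  ultimately show ?thesis by linarith
qed

text \<open>The cubic is odd about 1/2, so the lower bound is the upper bound at
  \<open>1 - y\<close>.\<close>

lemma abs_bernoulli3_le:
  fixes y :: real
  assumes "0 \<le> y" "y \<le> 1"
  shows "\<bar>y * (y - 1/2) * (y - 1)\<bar> \<le> 1/20"
proof -
  have "(1 - y) * (1 - y - 1/2) * (1 - y - 1) = - (y * (y - 1/2) * (y - 1))"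
    by (simp add: field_simps)
  then show ?thesis
    using bernoulli3_le[of y] bernoulli3_le[of "1 - y"] assms by linarith
qed

text \<open>With m = n + 1, this is (s - 1) s (s + 1) (s + 2) / 6 times the integral of
  \<open>B3 (x - m) * x powr (- s - 3)\<close> over [m, m + 1], where \<open>B3\<close> is the third
  Bernoulli polynomial. The closed form makes each term visibly entire in \<open>s\<close>.\<close>

definition euler_maclaurin_rem :: "nat \<Rightarrow> complex \<Rightarrow> complex" where
  "euler_maclaurin_rem n s =
     of_nat (Suc n) powr (1 - s) - of_nat (Suc (Suc n)) powr (1 - s)
     - (s - 1) / 2 * (of_nat (Suc n) powr - s + of_nat (Suc (Suc n)) powr - s)
     + (s - 1) * s / 12 * (of_nat (Suc n) powr (- s - 1) - of_nat (Suc (Suc n)) powr (- s - 1))"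

text \<open>Here 120 = 6 * 20, from the weight 1/3! of \<open>B3\<close> and its bound 1/20.\<close>

definition euler_maclaurin_const :: "complex \<Rightarrow> real" where
  "euler_maclaurin_const s = cmod ((s - 1) * s * (s + 1) * (s + 2)) / 120"

lemma norm_euler_maclaurin_rem_le:
  assumes s: "Re s \<ge> -1"
  shows "cmod (euler_maclaurin_rem n s) \<le>
           euler_maclaurin_const s * (1 / real (Suc n) - 1 / real (Suc (Suc n)))"
proof -
  define m where "m = real (Suc n)"
  have m: "m \<ge> 1" "of_nat (Suc n) = complex_of_real m" "of_nat (Suc (Suc n)) = complex_of_real (m + 1)"
    "real (Suc (Suc n)) = m + 1"
    by (simp_all add: m_def)
  define C where "C = (1 - s) * s * (s + 1) * (s + 2)"
  define B3 where "B3 = (\<lambda>y. y * (y - 1/2) * (y - 1) :: complex)"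
  \<comment> \<open>Repeated integration by parts of the derivative of \<open>z powr (1 - s)\<close>: since \<open>B\<^sub>k' = k B\<^sub>k\<^sub>-\<^sub>1\<close> for
    the Bernoulli polynomials, all terms of \<open>G'\<close> but the last cancel.\<close>
  define G where "G = (\<lambda>z. z powr (1 - s) - (z - of_real m - 1/2) * ((1 - s) * z powr - s)
     + ((z - of_real m)\<^sup>2 - (z - of_real m) + 1/6) / 2 * (- (1 - s) * s * z powr (- s - 1))
     - B3 (z - of_real m) / 6 * ((1 - s) * s * (s + 1) * z powr (- s - 2)))"
  have deriv: "(G has_field_derivative B3 (of_real (x - m)) / 6 * (C * of_real x powr (- s - 3)))
      (at (of_real x))" if "x > 0" for x
  proof -
    define w where "w = complex_of_real x"
    have "w \<notin> \<real>\<^sub>\<le>\<^sub>0" using that by (auto simp: w_def complex_nonpos_Reals_iff)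
    then have pw: "((\<lambda>z. z powr a) has_field_derivative a * w powr (a - 1)) (at w)" for a
      by (rule has_field_derivative_powr)
    have exps: "1 - s - 1 = - s" "- s - 1 - 1 = - s - 2" "- s - 2 - 1 = - s - 3" by simp_all
    note pws = pw[of "1 - s", unfolded exps] pw[of "- s"] pw[of "- s - 1", unfolded exps]
      pw[of "- s - 2", unfolded exps]
    have "(G has_field_derivative B3 (w - of_real m) / 6 * (C * w powr (- s - 3))) (at w)"
      unfolding G_def B3_def C_def
      by (rule pws derivative_eq_intros refl zero_neq_numeral[symmetric])+
        (simp add: field_simps power2_eq_square)
    then show ?thesis by (simp add: w_def)
  qed
  \<comment> \<open>An antiderivative of the bound \<open>cmod C / 120 / x\<^sup>2\<close> on the
    derivative of \<open>G\<close>; comparing increments avoids integrals.\<close>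
  define H where "H = (\<lambda>x::real. - (cmod C / 120) / x)"
  have "norm (G (of_real (m + 1)) - G (of_real m)) \<le> H (m + 1) - H m"
  proof (rule differentiable_bound_general)
    show "m < m + 1" by simp
    show "continuous_on {m..m + 1} H"
      using m unfolding H_def by (intro continuous_intros) auto
    show "(H has_vector_derivative cmod C / 120 / x\<^sup>2) (at x)" if "m < x" for x
      using that m unfolding H_def has_real_derivative_iff_has_vector_derivative[symmetric]
      by (auto intro!: derivative_eq_intros simp: power2_eq_square)
    have vd: "((\<lambda>x. G (of_real x)) has_vector_derivative
       B3 (of_real (x - m)) / 6 * (C * of_real x powr (- s - 3))) (at x within A)" if "m \<le> x" for x A
      by (rule has_vector_derivative_real_field, rule deriv) (use that m in auto)
    show "continuous_on {m..m + 1} (\<lambda>x. G (of_real x))"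
      by (rule continuous_on_vector_derivative) (use vd in auto)
    show "((\<lambda>x. G (of_real x)) has_vector_derivative
       B3 (of_real (x - m)) / 6 * (C * of_real x powr (- s - 3))) (at x)" if "m < x" for x
      using vd that by simp
    fix x assume x: "m < x" "x < m + 1"
    have "B3 (of_real (x - m)) = of_real ((x - m) * (x - m - 1/2) * (x - m - 1))"
      by (simp add: B3_def)
    then have "cmod (B3 (of_real (x - m))) \<le> 1/20"
      using abs_bernoulli3_le[of "x - m"] x by (simp only: norm_of_real)
    \<comment> \<open>The exponent has real part at most -2 because \<open>Re s \<ge> -1\<close>,
      and the base is at least 1.\<close>
    moreover have "cmod (of_real x powr (- s - 3)) \<le> x powr (-2)"
      using x m s by (subst norm_powr_real_powr) (auto intro!: powr_mono)
    moreover have "x powr (-2) = 1 / x\<^sup>2"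
      using x m by (simp add: powr_minus inverse_eq_divide)
    ultimately have "cmod (B3 (of_real (x - m)) / 6 * (C * of_real x powr (- s - 3))) \<le>
        (1/20) / 6 * (cmod C * (1 / x\<^sup>2))"
      unfolding norm_mult norm_divide by (intro mult_mono divide_right_mono) auto
    then show "cmod (B3 (of_real (x - m)) / 6 * (C * of_real x powr (- s - 3))) \<le> cmod C / 120 / x\<^sup>2"
      by simp
  qed
  \<comment> \<open>At the endpoints 0 and 1 the first Bernoulli polynomial is -1/2 and 1/2, the
    second is 1/6 twice, and \<open>B3\<close> vanishes.\<close>
  also have "G (of_real (m + 1)) - G (of_real m) = - euler_maclaurin_rem n s"
    unfolding G_def euler_maclaurin_rem_def m(2,3) B3_def by (simp add: field_simps)
  also have "H (m + 1) - H m = euler_maclaurin_const s * (1 / m - 1 / (m + 1))"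
  proof -
    have "euler_maclaurin_const s = cmod C / 120"
      by (simp add: euler_maclaurin_const_def C_def norm_mult norm_minus_commute)
    show ?thesis unfolding H_def \<open>euler_maclaurin_const s = cmod C / 120\<close> by (simp add: right_diff_distrib)
  qed
  finally show ?thesis unfolding m(4) by (simp add: m_def)
qed

lemma reciprocal_diff_sums: "(\<lambda>n. 1 / real (Suc n) - 1 / real (Suc (Suc n))) sums 1"
  using telescope_sums'[of "\<lambda>n. 1 / real (Suc n)" 0] LIMSEQ_Suc[OF lim_1_over_n] by simp

lemma norm_suminf_euler_maclaurin_rem_le:
  assumes "Re s \<ge> -1"
  shows "cmod (\<Sum>n. euler_maclaurin_rem n s) \<le> euler_maclaurin_const s"
proof -
  have *: "(\<lambda>n. euler_maclaurin_const s * (1 / real (Suc n) - 1 / real (Suc (Suc n)))) sums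
      euler_maclaurin_const s"
    using sums_mult[OF reciprocal_diff_sums] by simp
  show ?thesis
    using norm_suminf_le[OF norm_euler_maclaurin_rem_le[OF assms] sums_summable[OF *]] sums_unique[OF *]
    by simp
qed

lemma holomorphic_suminf_euler_maclaurin_rem:
  "(\<lambda>s. \<Sum>n. euler_maclaurin_rem n s) holomorphic_on {s. Re s > -1}"
proof (rule holomorphic_uniform_sequence)
  show op: "open {s. Re s > -1}" by (simp add: open_halfspace_Re_gt)
  show "(\<lambda>s. \<Sum>n<N. euler_maclaurin_rem n s) holomorphic_on {s. Re s > -1}" for N
    unfolding euler_maclaurin_rem_def
    by (intro holomorphic_intros) (auto simp: complex_nonpos_Reals_iff simp del: of_nat_Suc)
  fix s assume "s \<in> {s. Re s > -1}"
  then obtain d where d: "d > 0" "cball s d \<subseteq> {s. Re s > -1}"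
    using op open_contains_cball by blast
  \<comment> \<open>Continuity on a compact ball yields the uniform constant for the Weierstrass
    test.\<close>
  have "continuous_on (cball s d) euler_maclaurin_const"
    unfolding euler_maclaurin_const_def by (intro continuous_intros) auto
  then have "bounded (euler_maclaurin_const ` cball s d)"
    by (intro compact_imp_bounded compact_continuous_image) auto
  then obtain B where B: "\<And>w. w \<in> cball s d \<Longrightarrow> euler_maclaurin_const w \<le> B"
    unfolding bounded_iff by (fastforce simp: abs_le_iff)
  have "uniform_limit (cball s d) (\<lambda>N s. \<Sum>n<N. euler_maclaurin_rem n s)
          (\<lambda>s. \<Sum>n. euler_maclaurin_rem n s) sequentially"
  proof (rule Weierstrass_m_test)
    show "summable (\<lambda>n. B * (1 / real (Suc n) - 1 / real (Suc (Suc n))))"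
      by (intro summable_mult sums_summable[OF reciprocal_diff_sums])
    fix n w assume w: "w \<in> cball s d"
    have "cmod (euler_maclaurin_rem n w) \<le>
        euler_maclaurin_const w * (1 / real (Suc n) - 1 / real (Suc (Suc n)))"
      using w d by (intro norm_euler_maclaurin_rem_le) force
    also have "\<dots> \<le> B * (1 / real (Suc n) - 1 / real (Suc (Suc n)))"
      using B[OF w] by (intro mult_right_mono) (auto simp: field_simps)
    finally show "cmod (euler_maclaurin_rem n w) \<le> B * (1 / real (Suc n) - 1 / real (Suc (Suc n)))" .
  qed
  with d show "\<exists>d>0. cball s d \<subseteq> {s. Re s > -1} \<and>
      uniform_limit (cball s d) (\<lambda>N s. \<Sum>n<N. euler_maclaurin_rem n s)
        (\<lambda>s. \<Sum>n. euler_maclaurin_rem n s) sequentially"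
    by blast
qed

lemma euler_maclaurin_rem_sums:
  assumes s: "Re s > 1"
  shows "(\<lambda>n. euler_maclaurin_rem n s) sums ((s + 2) * (s + 3) / 12 - (s - 1) * zeta s)"
proof -
  have lim: "(\<lambda>n. of_nat (Suc n) powr a :: complex) \<longlonglongrightarrow> 0" if "Re a < 0" for a
    using tendsto_neg_powr_complex_of_nat [of "\<lambda>n. n" sequentially a] that
    by (intro LIMSEQ_Suc[of "\<lambda>n. of_nat n powr a"]) (simp add: filterlim_ident)
  have tele: "(\<lambda>n. of_nat (Suc n) powr a - of_nat (Suc (Suc n)) powr a :: complex) sums 1"
    if "Re a < 0" for a
    using telescope_sums'[OF lim[OF that]] by simp
  have z: "(\<lambda>n. of_nat (Suc n) powr - s) sums zeta s"
    using zeta_sums[OF s] by (simp add: powr_minus_divide del: of_nat_Suc)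
  \<comment> \<open>The shifted series starts at 2, so it lacks the first term 1.\<close>
  have z': "(\<lambda>n. of_nat (Suc (Suc n)) powr - s) sums (zeta s - 1)"
    using z by (subst sums_Suc_iff) simp
  have "(\<lambda>n. euler_maclaurin_rem n s) sums
          (1 - (s - 1) / 2 * (zeta s + (zeta s - 1)) + (s - 1) * s / 12 * 1)"
    unfolding euler_maclaurin_rem_def
    using s by (intro sums_add sums_diff sums_mult z z' tele) auto
  also have "1 - (s - 1) / 2 * (zeta s + (zeta s - 1)) + (s - 1) * s / 12 * 1 =
               (s + 2) * (s + 3) / 12 - (s - 1) * zeta s"
    by (simp add: field_simps)
  finally show ?thesis .
qed

theorem zeta_euler_maclaurin:
  assumes s: "Re s > -1" "s \<noteq> 1"
  shows "(s - 1) * zeta s = (s + 2) * (s + 3) / 12 - (\<Sum>n. euler_maclaurin_rem n s)"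
proof -
  obtain g where g: "g holomorphic_on UNIV" "\<And>s. s \<noteq> 1 \<Longrightarrow> zeta s = g s / (s - 1)"
    using zeta_eq_entire_divide by blast
  \<comment> \<open>Continuing the entire \<open>g\<close> instead of \<open>zeta\<close> keeps the
    pole out of the half-plane.\<close>
  have "g s = (s + 2) * (s + 3) / 12 - (\<Sum>n. euler_maclaurin_rem n s)"
  proof (rule analytic_continuation_open [of "{s. Re s > 1}" "{s. Re s > -1}" g])
    show "{s. Re s > 1} \<noteq> {}" by (auto intro: exI[of _ 2])
    show "connected {s. Re s > -1}" by (intro convex_connected convex_halfspace_Re_gt)
    show "g holomorphic_on {s. Re s > -1}" using g(1) by (rule holomorphic_on_subset) simp
    show "(\<lambda>s. (s + 2) * (s + 3) / 12 - (\<Sum>n. euler_maclaurin_rem n s)) holomorphic_on {s. Re s > -1}"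
      by (intro holomorphic_intros holomorphic_suminf_euler_maclaurin_rem) auto
    fix z assume z: "z \<in> {s. Re s > 1}"
    then have "z \<noteq> 1" by auto
    then have "g z = (z - 1) * zeta z" by (simp add: g(2))
    moreover have "(\<Sum>n. euler_maclaurin_rem n z) = (z + 2) * (z + 3) / 12 - (z - 1) * zeta z"
      using euler_maclaurin_rem_sums z by (intro sums_unique[symmetric]) auto
    ultimately show "g z = (z + 2) * (z + 3) / 12 - (\<Sum>n. euler_maclaurin_rem n z)"
      by simp
  qed (use s in \<open>auto simp: open_halfspace_Re_gt\<close>)
  then show ?thesis using g(2)[OF s(2)] s(2) by simp
qed

text \<open>The point 1 is excluded because \<open>zeta\<close> takes the default value 0 at its
  pole.\<close>

theorem mainTheorem2:
  fixes s :: complex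
  assumes "cmod (s - 1) \<le> 2.2093" and "0 \<le> Re s" and "Re s \<le> 1" and "s \<noteq> 1"
  shows "zeta s \<noteq> 0"
proof
  assume "zeta s = 0"
  then have "(s + 2) * (s + 3) / 12 = (\<Sum>n. euler_maclaurin_rem n s)"
    using zeta_euler_maclaurin[of s] assms by simp
  then have "cmod ((s + 2) * (s + 3) / 12) \<le> euler_maclaurin_const s"
    using norm_suminf_euler_maclaurin_rem_le[of s] assms by simp
  then have "cmod (s + 2) * (10 * cmod (s + 3)) \<le>
      cmod (s + 2) * (cmod (s - 1) * cmod s * cmod (s + 1))"
    unfolding euler_maclaurin_const_def norm_mult norm_divide by (simp add: mult_ac)
  moreover have "cmod (s + 2) > 0"
    using complex_Re_le_cmod[of "s + 2"] assms by (simp del: zero_less_norm_iff)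
  ultimately have "10 * cmod (s + 3) \<le> cmod (s - 1) * cmod s * cmod (s + 1)"
    by (simp only: mult_le_cancel_left_pos)
  \<comment> \<open>The triangle inequality around 1 bounds \<open>cmod s\<close> and
    \<open>cmod (s + 1)\<close>. The product is about 29.85, while \<open>Re (s + 3) \<ge> 3\<close>
    makes the left-hand side at least 30.\<close>
  also have "\<dots> \<le> 2.2093 * 3.2093 * 4.2093"
    using assms norm_triangle_ineq[of "s - 1" 1] norm_triangle_ineq[of "s - 1" 2]
    by (intro mult_mono) (auto simp: add.commute)
  finally have "cmod (s + 3) < 3" by simp
  then show False using complex_Re_le_cmod[of "s + 3"] assms by simp
qed

end
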